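(* In the setting of the context, let $U_0=(u^{(1)}(0),u^{(2)}(0),\dots)^\top\in\ell^2$. The initial value problem in $\ell^2$ $$\dot U(t)=\Big(4\big(1-3s(t)\big)B+8S\Big)U(t),\qquad U(0)=U_0,$$ has a unique solution $U\in C_b^\infty(\mathbb R_{\ge0};\ell^2)$, and it satisfies, for all $t\ge0$, $$U(t)=e^{4B\Theta(t)}U_0+8\int_0^te^{4B(\Theta(t)-\Theta(\tau))}\,(Bs_\star^\infty)\,u^{(1)}(\tau)\,d\tau,$$ where $u^{(1)}(\tau)=\langle e_1,U(\tau)\rangle$ and $\Theta(t)=\int_0^t(1-3s(\tau))\,d\tau$.
   Context: Let $d\ge2$, $Q=\mathrm{diag}(\lambda_1,\dots,\lambda_d)$ with $\lambda_1\ge\dots\ge\lambda_d>0$ and $\mathrm{tr}\,Q=1$; $w^\star\in\mathbb R^d$ with $(w^\star)^\top Qw^\star=1$; $\mathcal L(w)=\mathbb E_{x\sim\mathcal N(0,Q)}\big[((x^\top w)^2-(x^\top w^\star)^2)^2\big]$; $w(t)$, $t\ge 0$, is the solution of $\dot w=-\nabla\mathcal L(w)$ from a given $w(0)\in\mathbb R^d$. Put $s(t)=w(t)^\top Qw(t)$, $u^{(k)}(t)=w(t)^\top Q^kw^\star$, $s_\star^{(k)}=(w^\star)^\top Q^kw^\star$ for $k\ge1$. $\ell^2$ is the Hilbert space of square-summable real sequences $(x_k)_{k\ge1}$; $B:\ell^2\to\ell^2$ is the shift $(Bx)_k=x_{k+1}$; $e_1=(1,0,0,\dots)^\top$; $s_\star^\infty=(s_\star^{(1)},s_\star^{(2)},\dots)^\top\in\ell^2$;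 $S=(Bs_\star^\infty)e_1^\top$ is the rank-one operator $x\mapsto x_1\,Bs_\star^\infty$. $C_b^\infty(\mathbb R_{\ge0};\ell^2)$ is the space of bounded, infinitely differentiable functions $\mathbb R_{\ge0}\to\ell^2$. Exponentials of bounded operators are defined by the power series. *)

theory Defs
  imports "HOL-Analysis.Analysis"
begin

definition square_summable :: "(nat \<Rightarrow> real) \<Rightarrow> bool" where
  "square_summable x \<longleftrightarrow> summable (\<lambda>k. (x k)\<^sup>2)"

lemma square_summable_mult:
  assumes "square_summable x" "square_summable y"
  shows "summable (\<lambda>k. x k * y k)"
proof (rule summable_comparison_test')
  show "summable (\<lambda>k. (x k)\<^sup>2 + (y k)\<^sup>2)"
    using assms unfolding square_summable_def by (rule summable_add)
  have "\<bar>a * b\<bar> \<le> a\<^sup>2 + b\<^sup>2" for a b :: real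
  proof -
    have "2 * (\<bar>a\<bar> * \<bar>b\<bar>) \<le> a\<^sup>2 + b\<^sup>2"
      using sum_squares_bound[of "\<bar>a\<bar>" "\<bar>b\<bar>"] by (simp add: algebra_simps)
    moreover have "0 \<le> \<bar>a\<bar> * \<bar>b\<bar>" by simp
    ultimately show ?thesis unfolding abs_mult by linarith
  qed
  then show "norm (x k * y k) \<le> (x k)\<^sup>2 + (y k)\<^sup>2" if "k \<ge> 0" for k
    by simp
qed

lemma square_summable_zero: "square_summable (\<lambda>k. 0)"
  by (simp add: square_summable_def)

lemma square_summable_add:
  assumes "square_summable x" "square_summable y"
  shows "square_summable (\<lambda>k. x k + y k)"
  using summable_add[OF summable_add[OF assms[unfolded square_summable_def]]
      summable_mult[OF square_summable_mult[OF assms], of 2]]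
  unfolding square_summable_def by (simp add: power2_sum algebra_simps)

lemma square_summable_scale:
  assumes "square_summable x"
  shows "square_summable (\<lambda>k. c * x k)"
  using summable_mult[OF assms[unfolded square_summable_def], of "c\<^sup>2"]
  unfolding square_summable_def by (simp add: power_mult_distrib)

lemma square_summable_diff:
  assumes "square_summable x" "square_summable y"
  shows "square_summable (\<lambda>k. x k - y k)"
  using square_summable_add[OF assms(1) square_summable_scale[OF assms(2), of "-1"]] by simp

lemma square_summable_sum:
  assumes "finite I" "\<And>i. i \<in> I \<Longrightarrow> square_summable (f i)"
  shows "square_summable (\<lambda>k. \<Sum>i\<in>I. f i k)"
  using assms by (induction I rule: finite_induct) (auto intro: square_summable_zero square_summable_add)

text \<open>Sequences are indexed from \<open>0\<close>, so the coordinate $x_k$, $k \ge 1$, of the usual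
  convention is \<open>ell2_nth x (k - 1)\<close>.\<close>

typedef ell2 = "{x. square_summable x}"
  morphisms ell2_nth Abs_ell2
  using square_summable_zero by blast

setup_lifting type_definition_ell2

lemma ell2_nth_square_summable: "square_summable (ell2_nth x)"
  using ell2_nth by simp

lemma ell2_eqI: "(\<And>k. ell2_nth x k = ell2_nth y k) \<Longrightarrow> x = y"
  by (metis ell2_nth_inject ext)

lemma ell2_nth_Abs: "square_summable x \<Longrightarrow> ell2_nth (Abs_ell2 x) = x"
  by (simp add: Abs_ell2_inverse)

instantiation ell2 :: real_vector
begin

lift_definition zero_ell2 :: ell2 is "\<lambda>k. 0" by (rule square_summable_zero)
lift_definition plus_ell2 :: "ell2 \<Rightarrow> ell2 \<Rightarrow> ell2" is "\<lambda>x y k. x k + y k"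
  by (rule square_summable_add)
lift_definition minus_ell2 :: "ell2 \<Rightarrow> ell2 \<Rightarrow> ell2" is "\<lambda>x y k. x k - y k"
  by (rule square_summable_diff)
lift_definition uminus_ell2 :: "ell2 \<Rightarrow> ell2" is "\<lambda>x k. - x k"
  using square_summable_scale[of _ "-1"] by simp
lift_definition scaleR_ell2 :: "real \<Rightarrow> ell2 \<Rightarrow> ell2" is "\<lambda>c x k. c * x k"
  by (rule square_summable_scale)

instance
  by standard (transfer; simp add: algebra_simps)+

end

instantiation ell2 :: real_inner
begin

lift_definition inner_ell2 :: "ell2 \<Rightarrow> ell2 \<Rightarrow> real" is "\<lambda>x y. \<Sum>k. x k * y k" .

definition norm_ell2 :: "ell2 \<Rightarrow> real" where "norm_ell2 x = sqrt (x \<bullet> x)"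
definition dist_ell2 :: "ell2 \<Rightarrow> ell2 \<Rightarrow> real" where "dist_ell2 x y = norm (x - y)"
definition sgn_ell2 :: "ell2 \<Rightarrow> ell2" where "sgn_ell2 x = x /\<^sub>R norm x"
definition uniformity_ell2 :: "(ell2 \<times> ell2) filter" where
  "uniformity_ell2 = (INF e\<in>{0 <..}. principal {(x, y). dist x y < e})"
definition open_ell2 :: "ell2 set \<Rightarrow> bool" where
  "open_ell2 U \<longleftrightarrow> (\<forall>x\<in>U. \<forall>\<^sub>F (x', y) in uniformity. x' = x \<longrightarrow> y \<in> U)"

instance
proof
  fix x y z :: ell2 and r :: real and U :: "ell2 set"
  show "x \<bullet> y = y \<bullet> x"
    by transfer (simp add: mult.commute)
  show "(x + y) \<bullet> z = x \<bullet> z + y \<bullet> z"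
    by transfer (simp add: distrib_right suminf_add square_summable_mult)
  show "(r *\<^sub>R x) \<bullet> y = r * (x \<bullet> y)"
    by transfer (simp add: mult.assoc suminf_mult square_summable_mult)
  show "0 \<le> x \<bullet> x"
    by transfer (simp add: suminf_nonneg square_summable_mult)
  show "x \<bullet> x = 0 \<longleftrightarrow> x = 0"
    by transfer (auto simp add: suminf_eq_zero_iff square_summable_mult)
  show "norm x = sqrt (x \<bullet> x)" "dist x y = norm (x - y)" "sgn x = x /\<^sub>R norm x"
    by (simp_all add: norm_ell2_def dist_ell2_def sgn_ell2_def)
  show "(uniformity :: (ell2 \<times> ell2) filter) = (INF e\<in>{0 <..}. principal {(x, y). dist x y < e})"
    by (rule uniformity_ell2_def)
  show "open U \<longleftrightarrow> (\<forall>x\<in>U. \<forall>\<^sub>F (x', y) in uniformity. x' = x \<longrightarrow> y \<in> U)"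
    by (rule open_ell2_def)
qed

end

lemma ell2_nth_add: "ell2_nth (x + y) k = ell2_nth x k + ell2_nth y k"
  by transfer simp

lemma ell2_nth_diff: "ell2_nth (x - y) k = ell2_nth x k - ell2_nth y k"
  by transfer simp

lemma ell2_nth_scaleR: "ell2_nth (c *\<^sub>R x) k = c * ell2_nth x k"
  by transfer simp

lemma ell2_norm_square: "(norm x)\<^sup>2 = (\<Sum>k. (ell2_nth x k)\<^sup>2)"
  unfolding power2_norm_eq_inner by transfer (simp add: power2_eq_square)

lemma ell2_sum_le_norm: "(\<Sum>k<n. (ell2_nth x k)\<^sup>2) \<le> (norm x)\<^sup>2"
  unfolding ell2_norm_square
  by (rule sum_le_suminf) (use ell2_nth_square_summable[of x] in \<open>auto simp: square_summable_def\<close>)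

lemma ell2_nth_le_norm: "\<bar>ell2_nth x k\<bar> \<le> norm x"
proof -
  have "(ell2_nth x k)\<^sup>2 \<le> (\<Sum>j<Suc k. (ell2_nth x j)\<^sup>2)"
    by (simp add: sum_nonneg)
  also have "\<dots> \<le> (norm x)\<^sup>2" by (rule ell2_sum_le_norm)
  finally show ?thesis using abs_le_square_iff[of "ell2_nth x k" "norm x"] by simp
qed

instance ell2 :: complete_space
proof
  fix X :: "nat \<Rightarrow> ell2"
  assume X: "Cauchy X"
  have "Cauchy (\<lambda>n. ell2_nth (X n) k)" for k
  proof (rule metric_CauchyI)
    fix e :: real assume "e > 0"
    then obtain M where M: "\<And>m n. m \<ge> M \<Longrightarrow> n \<ge> M \<Longrightarrow> dist (X m) (X n) < e"
      using metric_CauchyD[OF X] by blast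
    have "dist (ell2_nth (X m) k) (ell2_nth (X n) k) < e" if "m \<ge> M" "n \<ge> M" for m n
      using ell2_nth_le_norm[of "X m - X n" k] M[OF that]
      by (simp add: dist_norm ell2_nth_diff)
    then show "\<exists>M. \<forall>m\<ge>M. \<forall>n\<ge>M. dist (ell2_nth (X m) k) (ell2_nth (X n) k) < e"
      by blast
  qed
  then have "\<forall>k. \<exists>l. (\<lambda>n. ell2_nth (X n) k) \<longlonglongrightarrow> l"
    by (simp add: Cauchy_convergent_iff convergent_def)
  then obtain y where y: "\<And>k. (\<lambda>n. ell2_nth (X n) k) \<longlonglongrightarrow> y k"
    by metis
  have bound: "\<exists>M. \<forall>n\<ge>M. \<forall>K. (\<Sum>k<K. (y k - ell2_nth (X n) k)\<^sup>2) \<le> e\<^sup>2" if e0: "e > 0" for e :: real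
  proof -
    obtain M where M: "\<And>m n. m \<ge> M \<Longrightarrow> n \<ge> M \<Longrightarrow> dist (X m) (X n) < e"
      using metric_CauchyD[OF X e0] by blast
    have "(\<Sum>k<K. (y k - ell2_nth (X n) k)\<^sup>2) \<le> e\<^sup>2" if n: "n \<ge> M" for n K
    proof (rule tendsto_upperbound)
      show "(\<lambda>m. \<Sum>k<K. (ell2_nth (X m) k - ell2_nth (X n) k)\<^sup>2)
              \<longlonglongrightarrow> (\<Sum>k<K. (y k - ell2_nth (X n) k)\<^sup>2)"
        by (intro tendsto_sum tendsto_power tendsto_diff y tendsto_const)
      show "\<forall>\<^sub>F m in sequentially. (\<Sum>k<K. (ell2_nth (X m) k - ell2_nth (X n) k)\<^sup>2) \<le> e\<^sup>2"
        unfolding eventually_sequentially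
      proof (intro exI allI impI)
        fix m assume "m \<ge> M"
        then have "norm (X m - X n) \<le> e" using M[OF _ n, of m] by (simp add: dist_norm less_imp_le)
        then have "(norm (X m - X n))\<^sup>2 \<le> e\<^sup>2" by (rule power_mono) simp
        then show "(\<Sum>k<K. (ell2_nth (X m) k - ell2_nth (X n) k)\<^sup>2) \<le> e\<^sup>2"
          using ell2_sum_le_norm[of "X m - X n" K] by (simp add: ell2_nth_diff)
      qed
    qed simp
    then show ?thesis by blast
  qed
  have diff: "square_summable (\<lambda>k. y k - ell2_nth (X n) k)"
    if "\<forall>K. (\<Sum>k<K. (y k - ell2_nth (X n) k)\<^sup>2) \<le> e\<^sup>2" for e n
    unfolding square_summable_def
    by (rule summableI_nonneg_bounded[where x = "e\<^sup>2"]) (rule zero_le_power2, rule that[THEN spec])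
  obtain n where "\<forall>K. (\<Sum>k<K. (y k - ell2_nth (X n) k)\<^sup>2) \<le> 1\<^sup>2"
    using bound[OF zero_less_one] by blast
  from square_summable_add[OF diff[OF this] ell2_nth_square_summable[of "X n"]]
  have y_ss: "square_summable y" by simp
  have "X \<longlonglongrightarrow> Abs_ell2 y"
  proof (rule metric_LIMSEQ_I)
    fix e :: real assume e: "e > 0"
    then obtain M where M: "\<And>n K. n \<ge> M \<Longrightarrow> (\<Sum>k<K. (y k - ell2_nth (X n) k)\<^sup>2) \<le> (e / 2)\<^sup>2"
      using bound[OF half_gt_zero[OF e]] by blast
    have "dist (X n) (Abs_ell2 y) < e" if "n \<ge> M" for n
    proof -
      have "(norm (Abs_ell2 y - X n))\<^sup>2 = (\<Sum>k. (y k - ell2_nth (X n) k)\<^sup>2)"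
        by (simp add: ell2_norm_square ell2_nth_diff ell2_nth_Abs y_ss)
      also have "\<dots> \<le> (e / 2)\<^sup>2"
      proof (rule suminf_le_const)
        have "\<forall>K. (\<Sum>k<K. (y k - ell2_nth (X n) k)\<^sup>2) \<le> (e / 2)\<^sup>2"
          using M[OF that] by blast
        then show "summable (\<lambda>k. (y k - ell2_nth (X n) k)\<^sup>2)"
          by (rule diff[unfolded square_summable_def])
      qed (rule M[OF that])
      finally have "norm (Abs_ell2 y - X n) \<le> e / 2"
        by (rule power2_le_imp_le) (simp add: e less_imp_le)
      then show ?thesis using e by (simp add: dist_norm norm_minus_commute)
    qed
    then show "\<exists>M. \<forall>n\<ge>M. dist (X n) (Abs_ell2 y) < e" by blast
  qed
  then show "convergent X" by (rule convergentI)
qed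

instance ell2 :: banach ..

lift_definition ell2_e1 :: ell2 is "\<lambda>k. if k = 0 then 1 else 0"
  unfolding square_summable_def by (rule summable_finite[of "{0}"]) auto

lemma inner_ell2_e1: "ell2_e1 \<bullet> x = ell2_nth x 0"
  by transfer (subst suminf_finite[of "{0}"], auto)

lift_definition ell2_shift_fun :: "ell2 \<Rightarrow> ell2" is "\<lambda>x k. x (Suc k)"
  unfolding square_summable_def by (subst summable_Suc_iff)

lemma bounded_linear_ell2_shift_fun: "bounded_linear ell2_shift_fun"
proof (rule bounded_linear_intro[where K = 1])
  show "ell2_shift_fun (x + y) = ell2_shift_fun x + ell2_shift_fun y" for x y
    by transfer simp
  show "ell2_shift_fun (r *\<^sub>R x) = r *\<^sub>R ell2_shift_fun x" for r x
    by transfer simp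
  fix x
  have "(norm (ell2_shift_fun x))\<^sup>2 \<le> (norm x)\<^sup>2"
    unfolding ell2_norm_square ell2_shift_fun.rep_eq
    using suminf_split_head[OF ell2_nth_square_summable[of x, unfolded square_summable_def]] by simp
  then show "norm (ell2_shift_fun x) \<le> norm x * 1"
    by (auto intro: power2_le_imp_le)
qed

lift_definition ell2_shift :: "ell2 \<Rightarrow>\<^sub>L ell2" is ell2_shift_fun
  by (rule bounded_linear_ell2_shift_fun)

lemma ell2_nth_shift: "ell2_nth (blinfun_apply ell2_shift x) k = ell2_nth x (Suc k)"
  by (simp add: ell2_shift.rep_eq ell2_shift_fun.rep_eq)

lift_definition rank_one :: "'a::real_inner \<Rightarrow> 'b::real_inner \<Rightarrow> 'b \<Rightarrow>\<^sub>L 'a" is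
  "\<lambda>y f x. (f \<bullet> x) *\<^sub>R y"
  by (intro bounded_linear_scaleR_const bounded_linear_inner_right)

definition blinfun_exp :: "('a::banach \<Rightarrow>\<^sub>L 'a) \<Rightarrow> ('a \<Rightarrow>\<^sub>L 'a)" where
  "blinfun_exp A = (\<Sum>n. (1 / fact n) *\<^sub>R (((o\<^sub>L) A ^^ n) id_blinfun))"

text \<open>A map on $[0,\infty)$ is represented by a total function on the reals of which only the
  restriction to \<open>{0..}\<close> matters; derivatives at \<open>0\<close> are one-sided. Only the function
  itself, not its derivatives, is required to be bounded.\<close>

definition Cb_infty :: "(real \<Rightarrow> 'a::real_normed_vector) set" where
  "Cb_infty = {f. bounded (f ` {0..}) \<and>
     (\<exists>D. D 0 = f \<and>
       (\<forall>n. \<forall>t\<ge>0. (D n has_vector_derivative D (Suc n) t) (at t within {0..})))}"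

definition solves_linear_ivp ::
    "(real \<Rightarrow> 'a \<Rightarrow>\<^sub>L 'a) \<Rightarrow> 'a::real_normed_vector \<Rightarrow> (real \<Rightarrow> 'a) \<Rightarrow> bool" where
  "solves_linear_ivp A x0 x \<longleftrightarrow> x 0 = x0 \<and>
     (\<forall>t\<ge>0. (x has_vector_derivative blinfun_apply (A t) (x t)) (at t within {0..}))"

definition gradient :: "('a::real_inner \<Rightarrow> real) \<Rightarrow> 'a \<Rightarrow> 'a" where
  "gradient f x = (THE D. GDERIV f x :> D)"

definition gradient_flow :: "('a::real_inner \<Rightarrow> real) \<Rightarrow> (real \<Rightarrow> 'a) \<Rightarrow> bool" where
  "gradient_flow f w \<longleftrightarrow>
     (\<forall>t\<ge>0. (w has_vector_derivative - gradient f (w t)) (at t within {0..}))"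

definition diag_matrix :: "real^'n \<Rightarrow> real^'n^'n" where
  "diag_matrix v = (\<chi> i j. if i = j then v $ i else 0)"

text \<open>The overloaded power on \<open>real^'n^'n\<close> is componentwise, hence the following definition.\<close>

definition matrix_pow :: "real^'n^'n \<Rightarrow> nat \<Rightarrow> real^'n^'n" where
  "matrix_pow A k = (((**) A) ^^ k) (mat 1)"

text \<open>The normal distribution with mean \<open>m\<close> and covariance matrix \<open>C\<close>, for symmetric
  positive definite \<open>C\<close>.\<close>

definition gaussian_density :: "real^'n \<Rightarrow> real^'n^'n \<Rightarrow> real^'n \<Rightarrow> real" where
  "gaussian_density m C x =
     exp (- ((x - m) \<bullet> (matrix_inv C *v (x - m))) / 2) / sqrt ((2 * pi) ^ CARD('n) * det C)"

definition gaussian :: "real^'n \<Rightarrow> real^'n^'n \<Rightarrow> (real^'n) measure" where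
  "gaussian m C = density lborel (\<lambda>x. ennreal (gaussian_density m C x))"

definition loss :: "real^'n^'n \<Rightarrow> real^'n \<Rightarrow> real^'n \<Rightarrow> real" where
  "loss Q wstar w = (\<integral>x. ((x \<bullet> w)\<^sup>2 - (x \<bullet> wstar)\<^sup>2)\<^sup>2 \<partial>gaussian 0 Q)"

lemma matrix_pow_diag: "matrix_pow (diag_matrix v) k = diag_matrix (\<chi> i. v $ i ^ k)"
proof (induction k)
  case 0
  show ?case by (simp add: matrix_pow_def diag_matrix_def mat_def vec_eq_iff)
next
  case (Suc k)
  have "matrix_pow (diag_matrix v) (Suc k) = diag_matrix v ** matrix_pow (diag_matrix v) k"
    by (simp add: matrix_pow_def)
  also have "\<dots> = diag_matrix v ** diag_matrix (\<chi> i. v $ i ^ k)"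
    by (simp only: Suc.IH)
  also have "\<dots> = diag_matrix (\<chi> i. v $ i ^ Suc k)"
    by (simp add: diag_matrix_def matrix_matrix_mult_def vec_eq_iff if_distrib[of "\<lambda>c. c * _"]
        cong: if_cong)
  finally show ?case .
qed

lemma inner_diag_matrix: "x \<bullet> (diag_matrix v *v y) = (\<Sum>i\<in>UNIV. v $ i * (x $ i * y $ i))"
  by (simp add: inner_vec_def diag_matrix_def matrix_vector_mult_def if_distrib if_distribR
      sum.If_cases mult_ac cong: if_cong)

text \<open>The sequences to which \<open>Abs_ell2\<close> is applied are square-summable, so no junk value of
  \<open>Abs_ell2\<close> occurs.\<close>

lemma square_summable_moments:
  fixes lam :: "real^'n"
  assumes "CARD('n) \<ge> 2" "\<And>i. lam $ i > 0" "trace (diag_matrix lam) = 1"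
  shows "square_summable (\<lambda>k. x \<bullet> (matrix_pow (diag_matrix lam) (Suc k) *v y))"
proof -
  have lt1: "lam $ i < 1" for i
  proof -
    have "sum (($) lam) UNIV = 1"
      using assms(3) by (simp add: trace_def diag_matrix_def)
    then have "lam $ i + sum (($) lam) (UNIV - {i}) = 1"
      by (simp add: sum.remove[of UNIV i])
    moreover have "sum (($) lam) (UNIV - {i}) > 0"
    proof (rule sum_pos)
      have "card (UNIV - {i}) \<noteq> 0" using assms(1) by (simp add: card_Diff_singleton)
      then show "UNIV - {i} \<noteq> {}" by force
    qed (use assms(2) in auto)
    ultimately show ?thesis by linarith
  qed
  have "square_summable (\<lambda>k. lam $ i ^ Suc k)" for i
  proof -
    have "(lam $ i)\<^sup>2 < 1"
      using lt1[of i] assms(2)[of i] by (simp add: power_less_one_iff)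
    then have "summable (\<lambda>k. (lam $ i)\<^sup>2 * ((lam $ i)\<^sup>2) ^ k)"
      by (intro summable_mult summable_geometric) simp
    then show ?thesis
      by (simp add: square_summable_def power_mult_distrib mult.commute flip: power_mult)
  qed
  then have "square_summable (\<lambda>k. \<Sum>i\<in>UNIV. (x $ i * y $ i) * lam $ i ^ Suc k)"
    by (intro square_summable_sum square_summable_scale) auto
  then show ?thesis
    by (simp add: matrix_pow_diag inner_diag_matrix mult_ac)
qed

end

theory Submission
  imports Defs "HOL-Probability.Probability"
begin

text \<open>
  A linear form $x^\top w$ of $x \sim \mathcal N(0, Q)$ is a centred normal variable of variance
  $w^\top Q w$, and polarization of its fourth moment gives
  $\mathcal L(w) = 3 s^2 - 2 s - 4 (u^{(1)})^2 + 3 \ge 3 (s - 1)^2$. Hence the flow is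
  $\dot w = 4 (1 - 3 s) Q w + 8 u^{(1)} Q w^\star$, and since $\mathcal L$ decreases along it, $s$ and
  $w$ stay bounded. The solution is $U = M w$, where $M$ is the linear map sending $w$ to the
  sequence of its moments $w^\top Q^k w^\star$, which intertwines $Q$ with $B$. It is smooth
  because the flow is polynomial, and unique because the operator $4 (1 - 3 s) B + 8 S$ is bounded
  uniformly in time.\<close>

section \<open>The population loss under a Gaussian with diagonal covariance\<close>

text \<open>\<open>nn_integral_lborel_prod\<close> runs over the vectors of \<open>Basis\<close>;
  the injection sending i to \<open>axis i 1\<close> has range \<open>Basis\<close>, and reindexing
  along it turns basis vectors into coordinates.\<close>

lemma nn_integral_lborel_prod_cart:
  fixes g :: "'n::finite \<Rightarrow> real \<Rightarrow> ennreal"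
  assumes [measurable]: "\<And>i. g i \<in> borel_measurable borel"
  shows "(\<integral>\<^sup>+x. (\<Prod>i\<in>UNIV. g i (x $ i)) \<partial>(lborel :: (real^'n) measure)) = (\<Prod>i\<in>UNIV. \<integral>\<^sup>+y. g i y \<partial>lborel)"
proof -
  define e :: "'n \<Rightarrow> real^'n" where "e i = axis i 1" for i
  have inj: "inj e"
    by (simp add: e_def inj_on_def axis_eq_axis)
  have Basis: "(Basis :: (real^'n) set) = range e"
    by (auto simp: Basis_vec_def e_def)
  have nth: "x \<bullet> e i = x $ i" for x i
    by (simp add: e_def inner_axis)
  have "(\<integral>\<^sup>+x. (\<Prod>b\<in>Basis. g (inv e b) (x \<bullet> b)) \<partial>(lborel :: (real^'n) measure))
      = (\<Prod>b\<in>(Basis::(real^'n) set). \<integral>\<^sup>+y. g (inv e b) y \<partial>lborel)"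
    by (rule nn_integral_lborel_prod) auto
  then show ?thesis
    unfolding Basis prod.reindex[OF inj] by (simp add: inj nth)
qed

text \<open>\<open>matrix_inv\<close> is a Hilbert choice, so its value is known to be an inverse
  only once some inverse is exhibited. The reciprocal diagonal serves as that witness, and
  associativity then forces the two to agree.\<close>

lemma matrix_inv_diag_matrix:
  assumes "\<And>i. v $ i \<noteq> 0"
  shows "matrix_inv (diag_matrix v) = diag_matrix (\<chi> i. inverse (v $ i))"
proof -
  let ?D = "diag_matrix v" and ?E = "diag_matrix (\<chi> i. inverse (v $ i))"
  have *: "?D ** ?E = mat 1" "?E ** ?D = mat 1"
    using assms
    by (simp_all add: diag_matrix_def matrix_matrix_mult_def vec_eq_iff mat_def
        if_distrib[of "\<lambda>c. c * _"] cong: if_cong)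
  have "matrix_inv ?D = ?E ** ?D ** matrix_inv ?D"
    by (simp add: *)
  also have "\<dots> = ?E ** (?D ** matrix_inv ?D)"
    by (simp add: matrix_mul_assoc)
  also have "?D ** matrix_inv ?D = mat 1"
    using someI[of "\<lambda>X. ?D ** X = mat 1 \<and> X ** ?D = mat 1" ?E] * by (simp add: matrix_inv_def)
  finally show ?thesis
    by simp
qed

lemma inner_diag_matrix_commute: "x \<bullet> (diag_matrix v *v y) = y \<bullet> (diag_matrix v *v x)"
  by (simp add: inner_diag_matrix mult_ac)

lemma sets_gaussian [measurable_cong]: "sets (gaussian m C) = sets borel"
  and space_gaussian: "space (gaussian m C) = UNIV"
  by (simp_all add: gaussian_def)

text \<open>For a diagonal covariance the determinant is a product and the quadratic form in the
  exponent is a sum over coordinates, so the density splits into one-dimensional normal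
  densities.\<close>

lemma gaussian_density_diag:
  fixes lam :: "real^'n"
  assumes pos: "\<And>i. lam $ i > 0"
  shows "gaussian_density 0 (diag_matrix lam) x = (\<Prod>i\<in>UNIV. normal_density 0 (sqrt (lam $ i)) (x $ i))"
proof -
  have "det (diag_matrix lam) = (\<Prod>i\<in>UNIV. lam $ i)"
    by (subst det_diagonal) (auto simp: diag_matrix_def)
  then have "(2 * pi) ^ CARD('n) * det (diag_matrix lam) = (\<Prod>i\<in>UNIV. 2 * pi * lam $ i)"
    by (simp add: prod.distrib power_mult_distrib)
  moreover have "sqrt (\<Prod>i\<in>I. f i) = (\<Prod>i\<in>I. sqrt (f i))" for I and f :: "'n \<Rightarrow> real"
    by (induction I rule: infinite_finite_induct) (simp_all add: real_sqrt_mult)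
  ultimately have sqrt: "sqrt ((2 * pi) ^ CARD('n) * det (diag_matrix lam)) = (\<Prod>i\<in>UNIV. sqrt (2 * pi * lam $ i))"
    by metis
  have "matrix_inv (diag_matrix lam) = diag_matrix (\<chi> i. inverse (lam $ i))"
    using pos by (intro matrix_inv_diag_matrix) (metis less_irrefl)
  then have expo: "- (x \<bullet> (matrix_inv (diag_matrix lam) *v x)) / 2 = (\<Sum>i\<in>UNIV. - (x $ i)\<^sup>2 / (2 * lam $ i))"
    by (simp add: inner_diag_matrix sum_negf sum_divide_distrib field_simps power2_eq_square)
  show ?thesis
    unfolding gaussian_density_def normal_density_def prod.distrib
    using pos expo sqrt
    by (simp add: exp_sum prod_dividef less_imp_le)
qed

section \<open>Coordinates and linear forms of a Gaussian vector, and the loss as a quartic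
  polynomial\<close>

context
  fixes lam :: "real^'n"
  assumes pos: "\<And>i. lam $ i > 0"
begin

text \<open>The source of all distributional facts below: taking every side to be
  \<open>UNIV\<close> gives the total mass, all sides but one gives the marginals, and general sides
  give independence.\<close>

lemma emeasure_gaussian_diag_box:
  assumes [measurable]: "\<And>i. A i \<in> sets borel"
  shows "emeasure (gaussian 0 (diag_matrix lam)) {x. \<forall>i. x $ i \<in> A i}
    = (\<Prod>i\<in>UNIV. emeasure (density lborel (normal_density 0 (sqrt (lam $ i)))) (A i))"
proof -
  have dens: "ennreal (gaussian_density 0 (diag_matrix lam) x)
      = (\<Prod>i\<in>UNIV. ennreal (normal_density 0 (sqrt (lam $ i)) (x $ i)))" for x
    unfolding gaussian_density_diag[OF pos] by (simp add: prod_ennreal)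
  have [measurable]: "{x::real^'n. \<forall>i. x $ i \<in> A i} \<in> sets borel"
    by measurable
  have "emeasure (gaussian 0 (diag_matrix lam)) {x. \<forall>i. x $ i \<in> A i}
      = (\<integral>\<^sup>+x. (\<Prod>i\<in>UNIV. ennreal (normal_density 0 (sqrt (lam $ i)) (x $ i)))
           * indicator {x. \<forall>i. x $ i \<in> A i} x \<partial>lborel)"
    unfolding gaussian_def dens by (subst emeasure_density) auto
  also have "\<dots> = (\<integral>\<^sup>+x. (\<Prod>i\<in>UNIV. ennreal (normal_density 0 (sqrt (lam $ i)) (x $ i))
           * indicator (A i) (x $ i)) \<partial>lborel)"
    by (auto intro!: nn_integral_cong simp: prod.distrib indicator_def)
  also have "\<dots> = (\<Prod>i\<in>UNIV. \<integral>\<^sup>+y. ennreal (normal_density 0 (sqrt (lam $ i)) y)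
           * indicator (A i) y \<partial>lborel)"
    by (rule nn_integral_lborel_prod_cart) auto
  finally show ?thesis
    by (simp add: emeasure_density)
qed

lemma prob_space_gaussian_diag: "prob_space (gaussian 0 (diag_matrix lam))"
proof
  have "emeasure (density lborel (normal_density 0 (sqrt (lam $ i)))) UNIV = 1" for i
    using prob_space.emeasure_space_1[OF prob_space_normal_density[of "sqrt (lam $ i)" 0]] pos by simp
  then show "emeasure (gaussian 0 (diag_matrix lam)) (space (gaussian 0 (diag_matrix lam))) = 1"
    using emeasure_gaussian_diag_box[of "\<lambda>_. UNIV"] by (simp add: space_gaussian)
qed

lemma distr_gaussian_diag_nth:
  "distr (gaussian 0 (diag_matrix lam)) borel (\<lambda>x. x $ i) = density lborel (normal_density 0 (sqrt (lam $ i)))"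
proof (rule measure_eqI)
  fix A assume "A \<in> sets (distr (gaussian 0 (diag_matrix lam)) borel (\<lambda>x. x $ i))"
  then have [measurable]: "A \<in> sets borel" by simp
  have one: "emeasure (density lborel (normal_density 0 (sqrt (lam $ i)))) UNIV = 1" for i
    using prob_space.emeasure_space_1[OF prob_space_normal_density[of "sqrt (lam $ i)" 0]] pos by simp
  have "emeasure (distr (gaussian 0 (diag_matrix lam)) borel (\<lambda>x. x $ i)) A
      = emeasure (gaussian 0 (diag_matrix lam)) {x. \<forall>j. x $ j \<in> (if j = i then A else UNIV)}"
    by (subst emeasure_distr) (auto simp: space_gaussian intro!: arg_cong2[where f = emeasure])
  also have "\<dots> = (\<Prod>j\<in>UNIV. emeasure (density lborel (normal_density 0 (sqrt (lam $ j)))) (if j = i then A else UNIV))"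
    by (rule emeasure_gaussian_diag_box) auto
  also have "\<dots> = (\<Prod>j\<in>UNIV. if j = i then emeasure (density lborel (normal_density 0 (sqrt (lam $ i)))) A else 1)"
    by (intro prod.cong) (auto simp: one)
  finally show "emeasure (distr (gaussian 0 (diag_matrix lam)) borel (\<lambda>x. x $ i)) A
      = emeasure (density lborel (normal_density 0 (sqrt (lam $ i)))) A"
    by simp
qed simp

lemma distributed_gaussian_diag_nth:
  "distributed (gaussian 0 (diag_matrix lam)) lborel (\<lambda>x. x $ i) (normal_density 0 (sqrt (lam $ i)))"
  unfolding distributed_def
  using distr_gaussian_diag_nth[of i] by (auto cong: distr_cong)

text \<open>The joint law of the coordinates and the product of the normal marginals agree on boxes,
  hence are equal by \<open>N.PiM_eqI\<close>; equality with the product of the marginals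
  characterizes independence.\<close>

lemma indep_vars_gaussian_diag_nth:
  "prob_space.indep_vars (gaussian 0 (diag_matrix lam)) (\<lambda>_. borel) (\<lambda>i x. x $ i) UNIV"
proof -
  interpret prob_space "gaussian 0 (diag_matrix lam)" by (rule prob_space_gaussian_diag)
  let ?N = "\<lambda>i. density lborel (normal_density 0 (sqrt (lam $ i)))"
  interpret N: product_prob_space ?N UNIV
    unfolding product_prob_space_def product_sigma_finite_def product_prob_space_axioms_def
    using prob_space_normal_density pos by (auto intro!: prob_space_imp_sigma_finite)
  have "distr (gaussian 0 (diag_matrix lam)) (PiM UNIV (\<lambda>_. borel)) (\<lambda>x. \<lambda>i\<in>UNIV. x $ i) = PiM UNIV ?N"
  proof (rule N.PiM_eqI)
    fix A assume A: "\<And>i. i \<in> UNIV \<Longrightarrow> A i \<in> sets (?N i)"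
    then have [measurable]: "A i \<in> sets borel" for i by simp
    have "emeasure (distr (gaussian 0 (diag_matrix lam)) (PiM UNIV (\<lambda>_. borel)) (\<lambda>x. \<lambda>i\<in>UNIV. x $ i)) (Pi\<^sub>E UNIV A)
        = emeasure (gaussian 0 (diag_matrix lam)) {x. \<forall>i. x $ i \<in> A i}"
      using sets_PiM_I_finite[of UNIV A "\<lambda>_. borel"]
      by (subst emeasure_distr) (auto simp: space_gaussian PiE_def intro!: arg_cong2[where f = emeasure])
    also have "\<dots> = (\<Prod>i\<in>UNIV. emeasure (?N i) (A i))"
      by (rule emeasure_gaussian_diag_box) simp
    finally show "emeasure (distr (gaussian 0 (diag_matrix lam)) (PiM UNIV (\<lambda>_. borel)) (\<lambda>x. \<lambda>i\<in>UNIV. x $ i)) (Pi\<^sub>E UNIV A)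
        = (\<Prod>i\<in>UNIV. emeasure (?N i) (A i))" .
  qed (auto cong: sets_PiM_cong)
  then show ?thesis
    by (subst indep_vars_iff_distr_eq_PiM) (auto simp: distr_gaussian_diag_nth)
qed

text \<open>A linear form is a sum of independent scaled normal coordinates, so it is normal and the
  variances add up. For w = 0 the law is a point mass, which has no density.\<close>

lemma distributed_gaussian_diag_inner:
  assumes "w \<noteq> 0"
  shows "distributed (gaussian 0 (diag_matrix lam)) lborel (\<lambda>x. x \<bullet> w)
           (normal_density 0 (sqrt (w \<bullet> (diag_matrix lam *v w))))"
proof -
  interpret prob_space "gaussian 0 (diag_matrix lam)" by (rule prob_space_gaussian_diag)
  \<comment> \<open>\<open>sum_indep_normal\<close> asks for strictly positive standard deviations,
    so the sum is restricted to the support of \<open>w\<close>, which is nonempty.\<close>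
  define I where "I = {i. w $ i \<noteq> 0}"
  have "I \<noteq> {}" using assms by (auto simp: I_def vec_eq_iff)
  have "indep_vars (\<lambda>_. borel) (\<lambda>i x. x $ i) I"
    by (rule indep_vars_subset[OF indep_vars_gaussian_diag_nth]) auto
  then have indep: "indep_vars (\<lambda>_. borel) (\<lambda>i x. w $ i * x $ i) I"
    using indep_vars_compose2[of "\<lambda>_. borel" "\<lambda>i x. x $ i" I "\<lambda>i y. w $ i * y" "\<lambda>_. borel"] by simp
  have "distributed (gaussian 0 (diag_matrix lam)) lborel (\<lambda>x. \<Sum>i\<in>I. w $ i * x $ i)
      (normal_density (\<Sum>i\<in>I. 0) (sqrt (\<Sum>i\<in>I. (\<bar>w $ i\<bar> * sqrt (lam $ i))\<^sup>2)))"
  proof (rule sum_indep_normal[OF _ \<open>I \<noteq> {}\<close> indep])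
    fix i assume "i \<in> I"
    then show "0 < \<bar>w $ i\<bar> * sqrt (lam $ i)" using pos by (simp add: I_def)
    show "distributed (gaussian 0 (diag_matrix lam)) lborel (\<lambda>x. w $ i * x $ i)
        (normal_density 0 (\<bar>w $ i\<bar> * sqrt (lam $ i)))"
      using normal_density_affine[OF distributed_gaussian_diag_nth[of i], of "w $ i" 0] \<open>i \<in> I\<close> pos
      by (simp add: I_def)
  qed simp
  moreover have "(\<Sum>i\<in>I. w $ i * x $ i) = x \<bullet> w" for x
    unfolding inner_vec_def by (rule sum.mono_neutral_cong_left) (auto simp: I_def)
  moreover have "(\<Sum>i\<in>I. (\<bar>w $ i\<bar> * sqrt (lam $ i))\<^sup>2) = w \<bullet> (diag_matrix lam *v w)"
    unfolding inner_diag_matrix using pos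
    by (intro sum.mono_neutral_cong_left)
       (auto simp: I_def power_mult_distrib less_imp_le simp flip: power2_eq_square)
  ultimately show ?thesis by simp
qed

lemma has_bochner_integral_gaussian_diag_power4:
  "has_bochner_integral (gaussian 0 (diag_matrix lam)) (\<lambda>x. (x \<bullet> w) ^ 4) (3 * (w \<bullet> (diag_matrix lam *v w))\<^sup>2)"
proof (cases "w = 0")
  case False
  let ?s = "w \<bullet> (diag_matrix lam *v w)"
  obtain i where "w $ i \<noteq> 0" using False by (auto simp: vec_eq_iff)
  then have s: "?s > 0"
    unfolding inner_diag_matrix using pos
    by (intro sum_pos2[of _ i]) (auto simp: less_imp_le zero_less_mult_iff not_le zero_le_mult_iff)
  \<comment> \<open>The factor 3 is 4! / (2^2 * 2!), the case k = 2 of the even moment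
    formula.\<close>
  have "has_bochner_integral lborel (\<lambda>x. normal_density 0 (sqrt ?s) x * x ^ 4) (3 * ?s\<^sup>2)"
    using normal_moment_even[of "sqrt ?s" 0 2] s
    by (simp add: fact_numeral power2_eq_square field_simps)
  moreover have "normal_density 0 (sqrt ?s) x \<ge> 0" for x by simp
  ultimately show ?thesis
    unfolding has_bochner_integral_iff
    using distributed_integrable[OF distributed_gaussian_diag_inner[OF False], of "\<lambda>y. y ^ 4"]
      distributed_integral[OF distributed_gaussian_diag_inner[OF False], of "\<lambda>y. y ^ 4"]
    by simp
qed (simp add: has_bochner_integral_zero)

text \<open>The identity (a^2 - b^2)^2 = (4/3) a^4 + (4/3) b^4 - (1/6) (a + b)^4 - (1/6) (a - b)^4
  reduces the integrand to fourth powers of single linear forms, so the joint law of the two forms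
  never enters.\<close>

lemma loss_diag:
  "loss (diag_matrix lam) v w
    = 3 * (w \<bullet> (diag_matrix lam *v w))\<^sup>2
      - 2 * ((w \<bullet> (diag_matrix lam *v w)) * (v \<bullet> (diag_matrix lam *v v)) + 2 * (w \<bullet> (diag_matrix lam *v v))\<^sup>2)
      + 3 * (v \<bullet> (diag_matrix lam *v v))\<^sup>2"
proof -
  let ?G = "gaussian 0 (diag_matrix lam)" and ?q = "\<lambda>a b. a \<bullet> (diag_matrix lam *v b)"
  have sym: "?q v w = ?q w v" by (rule inner_diag_matrix_commute)
  have "has_bochner_integral ?G
      (\<lambda>x. (4/3) * (x \<bullet> w) ^ 4 + (4/3) * (x \<bullet> v) ^ 4 - (1/6) * (x \<bullet> (w + v)) ^ 4 - (1/6) * (x \<bullet> (w - v)) ^ 4)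
      ((4/3) * (3 * (?q w w)\<^sup>2) + (4/3) * (3 * (?q v v)\<^sup>2)
        - (1/6) * (3 * (?q (w + v) (w + v))\<^sup>2) - (1/6) * (3 * (?q (w - v) (w - v))\<^sup>2))"
    by (intro has_bochner_integral_add has_bochner_integral_diff has_bochner_integral_mult_right
        has_bochner_integral_gaussian_diag_power4)
  moreover have "(4/3) * (x \<bullet> w) ^ 4 + (4/3) * (x \<bullet> v) ^ 4 - (1/6) * (x \<bullet> (w + v)) ^ 4 - (1/6) * (x \<bullet> (w - v)) ^ 4
      = ((x \<bullet> w)\<^sup>2 - (x \<bullet> v)\<^sup>2)\<^sup>2" for x
    unfolding inner_add_right inner_diff_right by algebra
  ultimately have "loss (diag_matrix lam) v w = (4/3) * (3 * (?q w w)\<^sup>2) + (4/3) * (3 * (?q v v)\<^sup>2)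
        - (1/6) * (3 * (?q (w + v) (w + v))\<^sup>2) - (1/6) * (3 * (?q (w - v) (w - v))\<^sup>2)"
    unfolding loss_def by (simp add: has_bochner_integral_integral_eq)
  moreover have "?q (w + v) (w + v) = ?q w w + ?q v v + 2 * ?q w v"
    "?q (w - v) (w - v) = ?q w w + ?q v v - 2 * ?q w v"
    using sym by (simp_all add: matrix_vector_right_distrib matrix_vector_mult_diff_distrib
        inner_add_left inner_diff_left inner_add_right inner_diff_right)
  ultimately show ?thesis by algebra
qed

end

section \<open>Linear and polynomial differential equations\<close>

text \<open>Termwise differentiation of the power series: the derivative of term n + 1 is term n
  composed with \<open>A\<close>, so uniform convergence of the differentiated series on a ball
  follows from that of the series itself.\<close>

lemma blinfun_exp_scaleR_has_vector_derivative:
  fixes A :: "'a::banach \<Rightarrow>\<^sub>L 'a"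
  shows "((\<lambda>x. blinfun_exp (x *\<^sub>R A)) has_vector_derivative blinfun_exp (x *\<^sub>R A) o\<^sub>L A) (at x)"
proof -
  interpret blinfun_compose: bounded_bilinear "(o\<^sub>L) :: ('a \<Rightarrow>\<^sub>L 'a) \<Rightarrow> _ \<Rightarrow> 'a \<Rightarrow>\<^sub>L 'a"
    by (rule bounded_bilinear_blinfun_compose)
  define pw where "pw n = ((o\<^sub>L) A ^^ n) id_blinfun" for n
  define f where "f n y = (y ^ n / fact n) *\<^sub>R pw n" for n and y :: real
  define f' where "f' n y = (case n of 0 \<Rightarrow> 0 | Suc m \<Rightarrow> f m y o\<^sub>L A)" for n and y :: real
  define E where "E y = blinfun_exp (y *\<^sub>R A)" for y
  \<comment> \<open>Any radius exceeding the modulus of \<open>x\<close> would do; the Weierstrass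
    test needs a bound uniform on a neighbourhood of \<open>x\<close>.\<close>
  define r where "r = \<bar>x\<bar> + 1"
  \<comment> \<open>The powers are built by composing with \<open>A\<close> on the left, whereas the
    derivative has \<open>A\<close> on the right.\<close>
  have pw_Suc: "pw (Suc n) = pw n o\<^sub>L A" for n
  proof (induction n)
    case (Suc n)
    have "pw (Suc (Suc n)) = A o\<^sub>L pw (Suc n)" by (simp add: pw_def)
    also have "\<dots> = (A o\<^sub>L pw n) o\<^sub>L A"
      unfolding Suc by (simp add: blinfun_eqI)
    finally show ?case by (simp add: pw_def)
  qed (simp add: pw_def blinfun_eqI)
  have norm_pw: "norm (pw n) \<le> norm A ^ n" for n
  proof (induction n)
    case (Suc n)
    have "norm (pw (Suc n)) \<le> norm (pw n) * norm A"
      unfolding pw_Suc by (rule norm_blinfun_compose)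
    also have "\<dots> \<le> norm A ^ n * norm A"
      using Suc by (intro mult_right_mono) auto
    finally show ?case by (simp add: mult.commute)
  qed (simp add: pw_def norm_blinfun_id_le)
  have "((o\<^sub>L) (y *\<^sub>R A) ^^ n) id_blinfun = y ^ n *\<^sub>R pw n" for y n
    by (induction n) (simp_all add: pw_def blinfun_compose.scaleR_left blinfun_compose.scaleR_right)
  then have E: "E y = (\<Sum>n. f n y)" for y
    by (simp add: E_def blinfun_exp_def f_def)
  have bound: "norm (f n y) \<le> inverse (fact n) * (r * norm A) ^ n" if "y \<in> ball 0 r" for n y
  proof -
    have "norm (f n y) \<le> \<bar>y\<bar> ^ n / fact n * norm A ^ n"
      using norm_pw[of n] by (auto simp: f_def power_abs intro!: mult_left_mono divide_right_mono)
    also have "\<dots> \<le> r ^ n / fact n * norm A ^ n"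
      using that by (intro mult_right_mono divide_right_mono power_mono) auto
    finally show ?thesis by (simp add: power_mult_distrib field_simps)
  qed
  have summ: "summable (\<lambda>n. inverse (fact n) * (r * norm A) ^ n)"
    by (rule summable_exp)
  have sums: "(\<lambda>n. f n y) sums E y" if "y \<in> ball 0 r" for y
    unfolding E by (intro summable_sums summable_comparison_test'[OF summ bound[OF that]])
  have unif: "uniform_limit (ball 0 r) (\<lambda>n y. \<Sum>i<n. f i y) E sequentially"
    unfolding E[abs_def] by (rule Weierstrass_m_test[OF bound summ])
  have "\<exists>g. \<forall>y\<in>ball 0 r. (\<lambda>n. f n y) sums g y \<and> (g has_derivative (\<lambda>h. h *\<^sub>R (E y o\<^sub>L A))) (at y within ball 0 r)"
  proof (rule has_derivative_series[where f' = "\<lambda>n y h. h *\<^sub>R f' n y"])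
    show "(f n has_derivative (\<lambda>h. h *\<^sub>R f' n y)) (at y within ball 0 r)" for n y
    proof (cases n)
      case 0
      then show ?thesis by (simp add: f_def[abs_def] f'_def)
    next
      case (Suc m)
      have "((\<lambda>y. y ^ Suc m / fact (Suc m)) has_real_derivative (y ^ m / fact m)) (at y within ball 0 r)"
        by (rule DERIV_cong[OF DERIV_cdivide[OF DERIV_pow]]) (simp del: of_nat_Suc)
      from has_vector_derivative_scaleR[OF this has_vector_derivative_const[of "pw n"]] show ?thesis
        by (simp add: Suc f_def[abs_def] f'_def pw_Suc has_vector_derivative_def blinfun_compose.scaleR_left)
    qed
  next
    fix e :: real assume "e > 0"
    \<comment> \<open>The denominator \<open>norm A + 1\<close> absorbs the factor
      \<open>norm A\<close> and stays positive when \<open>A\<close> is zero.\<close>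
    have "\<forall>\<^sub>F n in sequentially. \<forall>y\<in>ball 0 r. dist (\<Sum>i<n. f i y) (E y) < e / (norm A + 1)"
      using uniform_limitD[OF unif, of "e / (norm A + 1)"] \<open>e > 0\<close> by (simp add: add_nonneg_pos)
    \<comment> \<open>The derivative of term 0 vanishes, so n + 1 differentiated terms correspond to
      n terms of the series; \<open>eventually_sequentially_Suc\<close> removes the shift.\<close>
    then have "\<forall>\<^sub>F n in sequentially. \<forall>y\<in>ball 0 r. \<forall>h.
        norm (sum (\<lambda>i. h *\<^sub>R f' i y) {..<Suc n} - h *\<^sub>R (E y o\<^sub>L A)) \<le> e * norm h"
    proof eventually_elim
      case (elim n)
      show ?case
      proof (intro ballI allI)
        fix y h :: real assume y: "y \<in> ball 0 r"
        have "sum (\<lambda>i. h *\<^sub>R f' i y) {..<Suc n} - h *\<^sub>R (E y o\<^sub>L A) = h *\<^sub>R (((\<Sum>i<n. f i y) - E y) o\<^sub>L A)"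
          by (subst sum.lessThan_Suc_shift)
             (simp add: f'_def blinfun_compose.sum_left blinfun_compose.diff_left scaleR_diff_right scaleR_sum_right)
        also have "norm \<dots> \<le> \<bar>h\<bar> * (norm ((\<Sum>i<n. f i y) - E y) * norm A)"
          by (simp add: mult_left_mono norm_blinfun_compose)
        also have "\<dots> \<le> \<bar>h\<bar> * (e / (norm A + 1) * (norm A + 1))"
          using elim y \<open>e > 0\<close> by (intro mult_left_mono mult_mono) (auto simp: dist_norm less_imp_le)
        also have "\<dots> = e * norm h"
          by (simp add: add_nonneg_eq_0_iff)
        finally show "norm (sum (\<lambda>i. h *\<^sub>R f' i y) {..<Suc n} - h *\<^sub>R (E y o\<^sub>L A)) \<le> e * norm h" .
      qed
    qed
    then show "\<forall>\<^sub>F n in sequentially. \<forall>y\<in>ball 0 r. \<forall>h.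
        norm (sum (\<lambda>i. h *\<^sub>R f' i y) {..<n} - h *\<^sub>R (E y o\<^sub>L A)) \<le> e * norm h"
      by (subst (asm) eventually_sequentially_Suc)
  next
    show "x \<in> ball 0 r" by (simp add: r_def)
    then show "(\<lambda>n. f n x) sums E x" by (rule sums)
  qed simp
  then obtain g where g: "\<And>y. y \<in> ball 0 r \<Longrightarrow> (\<lambda>n. f n y) sums g y"
    "\<And>y. y \<in> ball 0 r \<Longrightarrow> (g has_derivative (\<lambda>h. h *\<^sub>R (E y o\<^sub>L A))) (at y within ball 0 r)"
    by blast
  have x: "x \<in> ball 0 r" by (simp add: r_def)
  \<comment> \<open>\<open>has_derivative_series\<close> yields some limit \<open>g\<close>;
    uniqueness of sums identifies it with \<open>E\<close> on the ball.\<close>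
  have "(E has_derivative (\<lambda>h. h *\<^sub>R (E x o\<^sub>L A))) (at x within ball 0 r)"
    by (rule has_derivative_transform[OF x _ g(2)[OF x]]) (rule sums_unique2[OF sums g(1)])
  moreover have "at x within ball 0 r = at x"
    by (rule at_within_open[OF x open_ball])
  ultimately show ?thesis
    unfolding has_vector_derivative_def E_def[abs_def] by simp
qed

lemma blinfun_exp_0: "blinfun_exp (0 :: 'a::banach \<Rightarrow>\<^sub>L 'a) = id_blinfun"
proof -
  let ?f = "\<lambda>n. (1 / fact n) *\<^sub>R (((o\<^sub>L) (0 :: 'a \<Rightarrow>\<^sub>L 'a) ^^ n) id_blinfun)"
  have "?f n = 0" if "n \<notin> {0}" for n
    using that by (cases n) auto
  then have "suminf ?f = sum ?f {0}"
    by (intro suminf_finite) auto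
  then show ?thesis
    by (simp add: blinfun_exp_def)
qed

text \<open>Differentiate $e^{(c(t) - c(\tau)) A} U(\tau)$ in $\tau$.\<close>

lemma variation_of_constants_blinfun_exp:
  fixes A :: "'a::banach \<Rightarrow>\<^sub>L 'a"
  assumes t: "t \<ge> 0"
    and c: "\<And>\<tau>. \<tau> \<in> {0..t} \<Longrightarrow> (c has_real_derivative c' \<tau>) (at \<tau> within {0..t})"
    and U: "\<And>\<tau>. \<tau> \<in> {0..t} \<Longrightarrow> (U has_vector_derivative c' \<tau> *\<^sub>R A (U \<tau>) + g \<tau>) (at \<tau> within {0..t})"
  shows "((\<lambda>\<tau>. blinfun_exp ((c t - c \<tau>) *\<^sub>R A) (g \<tau>)) has_integral
           (U t - blinfun_exp ((c t - c 0) *\<^sub>R A) (U 0))) {0..t}"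
proof -
  define E where "E \<tau> = blinfun_exp ((c t - c \<tau>) *\<^sub>R A)" for \<tau>
  have "((\<lambda>\<tau>. E \<tau> (U \<tau>)) has_vector_derivative E \<tau> (g \<tau>)) (at \<tau> within {0..t})" if "\<tau> \<in> {0..t}" for \<tau>
  proof -
    have "((\<lambda>\<tau>. c t - c \<tau>) has_vector_derivative - c' \<tau>) (at \<tau> within {0..t})"
      using DERIV_diff[OF DERIV_const c[OF that]]
      by (simp add: has_real_derivative_iff_has_vector_derivative)
    from vector_diff_chain_within[OF this
        has_vector_derivative_at_within[OF blinfun_exp_scaleR_has_vector_derivative[of A]]]
    have "(E has_vector_derivative - c' \<tau> *\<^sub>R (E \<tau> o\<^sub>L A)) (at \<tau> within {0..t})"
      by (simp add: E_def[abs_def] o_def)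
    \<comment> \<open>In the product rule the term with \<open>A (U \<tau>)\<close> cancels against
      the derivative of the exponential, leaving only the forcing term.\<close>
    from bounded_bilinear.has_vector_derivative[OF bounded_bilinear_blinfun_apply this U[OF that]]
    show ?thesis
      by (simp add: blinfun.add_right blinfun.scaleR_right blinfun.scaleR_left blinfun.minus_left)
  qed
  from fundamental_theorem_of_calculus[OF t this] show ?thesis
    by (simp add: E_def blinfun_exp_0)
qed

section \<open>Energy estimates, uniqueness and smoothness on the half-line\<close>

text \<open>At interior points the one-sided derivative is an ordinary one, and continuity takes
  care of the endpoint 0. It serves both the uniqueness estimate and the decay of the loss.\<close>

lemma nonincreasing_on_halfline:
  fixes f :: "real \<Rightarrow> real"
  assumes deriv: "\<And>t. t \<ge> 0 \<Longrightarrow> (f has_real_derivative f' t) (at t within {0..})"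
    and nonpos: "\<And>t. t \<ge> 0 \<Longrightarrow> f' t \<le> 0" and "t \<ge> 0"
  shows "f t \<le> f 0"
proof (rule DERIV_nonpos_imp_decreasing_open[OF \<open>t \<ge> 0\<close>])
  show "\<exists>y. DERIV f x :> y \<and> y \<le> 0" if "0 < x" "x < t" for x
  proof -
    have "at x within {0..} = at x"
      using that by (intro at_within_interior) simp
    then show ?thesis
      using deriv[of x] nonpos[of x] that by (intro exI[of _ "f' x"]) simp
  qed
  show "continuous_on {0..t} f"
    by (rule continuous_on_subset[OF DERIV_continuous_on[of "{0..}" f f']]) (use deriv in auto)
qed

text \<open>A Gronwall argument: the difference z of two solutions satisfies (|z|^2)' <= 2 C |z|^2
  and starts at 0, so exp(-2 C t) |z|^2 is nonincreasing and never leaves 0.\<close>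

lemma solves_linear_ivp_unique:
  fixes x y :: "real \<Rightarrow> 'a::real_inner"
  assumes x: "solves_linear_ivp A x0 x" and y: "solves_linear_ivp A x0 y"
    and bound: "\<And>t. t \<ge> 0 \<Longrightarrow> norm (A t) \<le> C" and t: "t \<ge> 0"
  shows "x t = y t"
proof -
  define z where "z t = x t - y t" for t
  have z': "(z has_vector_derivative A t (z t)) (at t within {0..})" if "t \<ge> 0" for t
    using has_vector_derivative_diff[of x "A t (x t)" _ y "A t (y t)"] x y that
    unfolding z_def[abs_def] solves_linear_ivp_def by (simp add: blinfun.diff_right)
  define f where "f t = exp (- (2 * C * t)) * (z t \<bullet> z t)" for t
  have "f t \<le> f 0"
  proof (rule nonincreasing_on_halfline[OF _ _ t])
    fix s :: real assume s: "s \<ge> 0"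
    have inner: "((\<lambda>t. z t \<bullet> z t) has_real_derivative 2 * (z s \<bullet> A s (z s))) (at s within {0..})"
      using has_derivative_inner[OF z'[OF s, unfolded has_vector_derivative_def] z'[OF s, unfolded has_vector_derivative_def]]
      by (simp add: has_field_derivative_def inner_commute algebra_simps mult_commute_abs)
    show "(f has_real_derivative exp (- (2 * C * s)) * (2 * (z s \<bullet> A s (z s)) - 2 * C * (z s \<bullet> z s))) (at s within {0..})"
      unfolding f_def[abs_def]
      by (rule derivative_eq_intros inner refl)+ (simp add: algebra_simps)
    have "z s \<bullet> A s (z s) \<le> norm (z s) * norm (A s (z s))" by (rule norm_cauchy_schwarz)
    also have "\<dots> \<le> norm (z s) * (C * norm (z s))"
      using norm_blinfun[of "A s" "z s"] mult_right_mono[OF bound[OF s] norm_ge_zero[of "z s"]]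
      by (intro mult_left_mono) auto
    finally show "exp (- (2 * C * s)) * (2 * (z s \<bullet> A s (z s)) - 2 * C * (z s \<bullet> z s)) \<le> 0"
      by (intro mult_nonneg_nonpos) (auto simp: dot_square_norm power2_eq_square algebra_simps)
  qed
  also have "f 0 = 0"
    using x y by (simp add: f_def z_def solves_linear_ivp_def)
  finally have "z t \<bullet> z t \<le> 0"
    by (simp add: f_def mult_le_0_iff not_le)
  then have "z t = 0"
    by (metis inner_eq_zero_iff inner_ge_zero order_antisym)
  then show ?thesis by (simp add: z_def)
qed

text \<open>Polynomial observables of the solution of a polynomial differential equation are closed
  under differentiation in time, whence smoothness.\<close>

lemma real_polynomial_function_along_solution:
  fixes w :: "real \<Rightarrow> 'a::real_normed_vector"
  assumes w: "\<And>t. t \<in> T \<Longrightarrow> (w has_vector_derivative F (w t)) (at t within T)"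
    and F: "polynomial_function F" and p: "real_polynomial_function p"
  shows "\<exists>q. real_polynomial_function q \<and>
    (\<forall>t\<in>T. ((\<lambda>t. p (w t)) has_real_derivative q (w t)) (at t within T))"
  using p
proof induction
  case (linear f)
  \<comment> \<open>By definition, a vector-valued polynomial function becomes a real polynomial
    under every bounded linear functional, which is what the chain rule produces here.\<close>
  have "real_polynomial_function (\<lambda>x. f (F x))"
    using F linear by (auto simp: polynomial_function_def o_def)
  moreover have "((\<lambda>t. f (w t)) has_real_derivative f (F (w t))) (at t within T)" if "t \<in> T" for t
    using bounded_linear.has_vector_derivative[OF linear w[OF that]]
    by (simp add: has_real_derivative_iff_has_vector_derivative)
  ultimately show ?case by blast
next
  case (const c)
  have "real_polynomial_function (\<lambda>x::'a. 0)" by auto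
  then show ?case by fastforce
next
  case (add f g)
  then obtain f' g' where "real_polynomial_function f'" "real_polynomial_function g'"
    "\<forall>t\<in>T. ((\<lambda>t. f (w t)) has_real_derivative f' (w t)) (at t within T)"
    "\<forall>t\<in>T. ((\<lambda>t. g (w t)) has_real_derivative g' (w t)) (at t within T)" by blast
  then show ?case
    by (intro exI[of _ "\<lambda>x. f' x + g' x"]) (auto intro!: DERIV_add)
next
  case (mult f g)
  then obtain f' g' where *: "real_polynomial_function f'" "real_polynomial_function g'"
    "\<forall>t\<in>T. ((\<lambda>t. f (w t)) has_real_derivative f' (w t)) (at t within T)"
    "\<forall>t\<in>T. ((\<lambda>t. g (w t)) has_real_derivative g' (w t)) (at t within T)" by blast
  then have "real_polynomial_function (\<lambda>x. f' x * g x + g' x * f x)"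
    using mult.hyps by auto
  moreover have "\<forall>t\<in>T. ((\<lambda>t. f (w t) * g (w t)) has_real_derivative f' (w t) * g (w t) + g' (w t) * f (w t)) (at t within T)"
    using * by (auto intro!: DERIV_mult)
  ultimately show ?case by (intro exI[of _ "\<lambda>x. f' x * g x + g' x * f x"]) blast
qed

text \<open>Only the scalar coefficients depend on time, so each derivative is again a combination
  of the same vectors \<open>v i\<close> with polynomial coefficients along the flow.\<close>

lemma Cb_infty_polynomial_flow:
  fixes w :: "real \<Rightarrow> 'a::real_normed_vector" and v :: "'i \<Rightarrow> 'b::real_normed_vector"
  assumes w: "\<And>t. t \<ge> 0 \<Longrightarrow> (w has_vector_derivative F (w t)) (at t within {0..})"
    and F: "polynomial_function F" and p: "\<And>i. i \<in> I \<Longrightarrow> real_polynomial_function (p i)"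
    and bdd: "bounded ((\<lambda>t. \<Sum>i\<in>I. p i (w t) *\<^sub>R v i) ` {0..})"
  shows "(\<lambda>t. \<Sum>i\<in>I. p i (w t) *\<^sub>R v i) \<in> Cb_infty"
proof -
  \<comment> \<open>Putting the polynomial hypothesis under the existential quantifier makes the
    choice of \<open>d\<close> total, so that \<open>d\<close> can be iterated to supply all
    derivatives.\<close>
  have "\<forall>q. \<exists>q'. real_polynomial_function q \<longrightarrow> (real_polynomial_function q' \<and>
      (\<forall>t\<in>{0..}. ((\<lambda>t. q (w t)) has_real_derivative q' (w t)) (at t within {0..})))"
    using real_polynomial_function_along_solution[OF _ F, where w = w and T = "{0..}"] w by (metis atLeast_iff)
  then obtain d where d: "\<And>q. real_polynomial_function q \<Longrightarrow> real_polynomial_function (d q)"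
    "\<And>q t. real_polynomial_function q \<Longrightarrow> t \<ge> 0 \<Longrightarrow>
       ((\<lambda>t. q (w t)) has_real_derivative d q (w t)) (at t within {0..})"
    by (metis atLeast_iff)
  define D where "D n t = (\<Sum>i\<in>I. (d ^^ n) (p i) (w t) *\<^sub>R v i)" for n t
  have poly: "real_polynomial_function ((d ^^ n) (p i))" if "i \<in> I" for n i
    by (induction n) (auto simp: p d that)
  have "(D n has_vector_derivative D (Suc n) t) (at t within {0..})" if "t \<ge> 0" for n t
    unfolding D_def[abs_def]
  proof (rule has_vector_derivative_sum)
    fix i assume "i \<in> I"
    from has_vector_derivative_scaleR[OF d(2)[OF poly[OF this] that] has_vector_derivative_const]
    show "((\<lambda>t. (d ^^ n) (p i) (w t) *\<^sub>R v i) has_vector_derivative (d ^^ Suc n) (p i) (w t) *\<^sub>R v i) (at t within {0..})"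
      by simp
  qed
  moreover have "D 0 = (\<lambda>t. \<Sum>i\<in>I. p i (w t) *\<^sub>R v i)" by (simp add: D_def[abs_def])
  ultimately show ?thesis using bdd unfolding Cb_infty_def by blast
qed

section \<open>The gradient flow and its moments\<close>

text \<open>\<open>gradient\<close> is a definite description; two candidates induce the same
  derivative, and testing it on their difference shows that they coincide.\<close>

lemma gradient_eqI:
  assumes "GDERIV f x :> D"
  shows "gradient f x = D"
  unfolding gradient_def
proof (rule the_equality, rule assms)
  fix D' assume "GDERIV f x :> D'"
  with assms have "(\<lambda>h. h \<bullet> D) = (\<lambda>h. h \<bullet> D')"
    unfolding gderiv_def by (rule has_derivative_unique)
  then have "(D' - D) \<bullet> D = (D' - D) \<bullet> D'"
    by (rule fun_cong)
  then have "(D' - D) \<bullet> (D' - D) = 0"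
    by (simp only: inner_diff_right diff_self)
  then show "D' = D"
    by simp
qed

text \<open>Along the flow the chain rule gives minus the squared norm of the gradient.\<close>

lemma gradient_flow_nonincreasing:
  assumes flow: "gradient_flow f w" and f: "\<And>x. GDERIV f x :> gradient f x" and "t \<ge> 0"
  shows "f (w t) \<le> f (w 0)"
proof (rule nonincreasing_on_halfline[OF _ _ \<open>t \<ge> 0\<close>])
  fix s :: real assume s: "s \<ge> 0"
  let ?D = "gradient f (w s)"
  have "(w has_derivative (\<lambda>h. h *\<^sub>R - ?D)) (at s within {0..})"
    using flow s by (simp add: gradient_flow_def has_vector_derivative_def)
  from has_derivative_compose[OF this f[of "w s", unfolded gderiv_def]]
  show "((\<lambda>t. f (w t)) has_real_derivative - (?D \<bullet> ?D)) (at s within {0..})"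
    unfolding has_field_derivative_def by (rule has_derivative_eq_rhs) (simp add: fun_eq_iff)
  show "- (?D \<bullet> ?D) \<le> 0" by simp
qed

text \<open>The linear map M of the overview: U(t) is its value at w(t), and the sequence of the
  moments of \<open>wstar\<close> is its value at \<open>wstar\<close>.\<close>

definition moments :: "real^'n \<Rightarrow> real^'n \<Rightarrow> real^'n \<Rightarrow> ell2" where
  "moments lam v x = Abs_ell2 (\<lambda>k. x \<bullet> (matrix_pow (diag_matrix lam) (Suc k) *v v))"

lemma diag_matrix_vector_mult: "diag_matrix v *v x = (\<chi> i. v $ i * x $ i)"
  by (simp add: diag_matrix_def matrix_vector_mult_def vec_eq_iff if_distrib[of "\<lambda>c. c * _"] cong: if_cong)

text \<open>A diagonal matrix is symmetric, so one factor moves to the left argument. This is the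
  origin of the shift operator.\<close>

lemma inner_matrix_pow_Suc_diag:
  "x \<bullet> (matrix_pow (diag_matrix lam) (Suc k) *v y)
    = (diag_matrix lam *v x) \<bullet> (matrix_pow (diag_matrix lam) k *v y)"
  by (simp add: matrix_pow_diag diag_matrix_vector_mult inner_vec_def mult_ac)

lemma matrix_pow_1: "matrix_pow A 1 = A"
  by (simp add: matrix_pow_def)

text \<open>The negative gradient of the loss once v is normalized, written out to exhibit it as a
  cubic polynomial.\<close>

definition flow_field :: "real^'n \<Rightarrow> real^'n \<Rightarrow> real^'n \<Rightarrow> real^'n" where
  "flow_field lam v w =
     (4 * (1 - 3 * (w \<bullet> (diag_matrix lam *v w)))) *\<^sub>R (diag_matrix lam *v w)
     + (8 * (w \<bullet> (diag_matrix lam *v v))) *\<^sub>R (diag_matrix lam *v v)"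

lemma polynomial_function_flow_field:
  fixes lam v :: "real^'n"
  shows "polynomial_function (flow_field lam v)"
  unfolding polynomial_function_def o_def
proof (intro allI impI)
  fix f :: "real^'n \<Rightarrow> real" assume f: "bounded_linear f"
  interpret f: bounded_linear f by (rule f)
  have nth: "real_polynomial_function (\<lambda>w::real^'n. w $ i)" for i
    by (intro real_polynomial_function.intros(1) bounded_linear_vec_nth)
  have s: "real_polynomial_function (\<lambda>w. w \<bullet> (diag_matrix lam *v w))"
    unfolding inner_diag_matrix
    by (intro real_polynomial_function_sum real_polynomial_function.intros(4) real_polynomial_function.intros(2) nth) auto
  have u: "real_polynomial_function (\<lambda>w. w \<bullet> (diag_matrix lam *v v))"
    by (intro real_polynomial_function.intros(1) bounded_linear_inner_left)
  have fQ: "real_polynomial_function (\<lambda>w. f (diag_matrix lam *v w))"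
    by (intro real_polynomial_function.intros(1) bounded_linear_compose[OF f] matrix_vector_mul_bounded_linear)
  show "real_polynomial_function (\<lambda>w. f (flow_field lam v w))"
    unfolding flow_field_def f.add f.scaleR real_scaleR_def
    by (intro real_polynomial_function.intros(3) real_polynomial_function.intros(4) real_polynomial_function.intros(2)
        real_polynomial_function_diff s u fQ)
qed

context
  fixes lam v :: "real^'n"
  assumes pos: "\<And>i. lam $ i > 0" and v: "v \<bullet> (diag_matrix lam *v v) = 1"
begin

lemma GDERIV_loss_diag: "GDERIV (loss (diag_matrix lam) v) w :> - flow_field lam v w"
proof -
  let ?Q = "diag_matrix lam"
  have Q: "((*v) ?Q has_derivative (*v) ?Q) (at w)"
    by (rule bounded_linear_imp_has_derivative[OF matrix_vector_mul_bounded_linear])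
  have s: "((\<lambda>w. w \<bullet> (?Q *v w)) has_derivative (\<lambda>h. 2 * (h \<bullet> (?Q *v w)))) (at w)"
    by (rule has_derivative_eq_rhs[OF has_derivative_inner[OF has_derivative_ident Q]])
      (simp add: fun_eq_iff inner_diag_matrix_commute[of w lam])
  have u: "((\<lambda>w. w \<bullet> (?Q *v v)) has_derivative (\<lambda>h. h \<bullet> (?Q *v v))) (at w)"
    by (rule bounded_linear_imp_has_derivative[OF bounded_linear_inner_left])
  have "loss ?Q v = (\<lambda>w. 3 * (w \<bullet> (?Q *v w))\<^sup>2 - 2 * (w \<bullet> (?Q *v w) + 2 * (w \<bullet> (?Q *v v))\<^sup>2) + 3)"
    using loss_diag[OF pos] v by (simp add: fun_eq_iff)
  moreover have "((\<lambda>w. 3 * (w \<bullet> (?Q *v w))\<^sup>2 - 2 * (w \<bullet> (?Q *v w) + 2 * (w \<bullet> (?Q *v v))\<^sup>2) + 3)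
      has_derivative (\<lambda>h. h \<bullet> - flow_field lam v w)) (at w)"
    by (rule derivative_eq_intros s u refl)+
      (simp add: fun_eq_iff flow_field_def inner_add_right algebra_simps)
  ultimately show ?thesis by (simp add: gderiv_def)
qed

text \<open>Positivity of the quadratic form at the component of \<open>w\<close> orthogonal to
  \<open>v\<close> is Cauchy-Schwarz, u^2 <= s; inserting it into the formula for the loss leaves 3
  s^2 - 6 s + 3.\<close>

lemma loss_diag_ge: "loss (diag_matrix lam) v w \<ge> 3 * (w \<bullet> (diag_matrix lam *v w) - 1)\<^sup>2"
proof -
  let ?Q = "diag_matrix lam"
  let ?u = "w \<bullet> (?Q *v v)"
  have "0 \<le> (w - ?u *\<^sub>R v) \<bullet> (?Q *v (w - ?u *\<^sub>R v))"
    unfolding inner_diag_matrix using pos by (intro sum_nonneg) (simp add: less_imp_le)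
  also have "\<dots> = w \<bullet> (?Q *v w) - ?u\<^sup>2"
    using v inner_diag_matrix_commute[of v lam w]
    by (simp add: matrix_vector_mult_diff_distrib matrix_vector_mult_scaleR
        inner_diff_left inner_diff_right power2_eq_square algebra_simps)
  finally show ?thesis
    unfolding loss_diag[OF pos] v by (simp add: power2_eq_square algebra_simps)
qed

lemma has_vector_derivative_gradient_flow_loss_diag:
  assumes "gradient_flow (loss (diag_matrix lam) v) w" "t \<ge> 0"
  shows "(w has_vector_derivative flow_field lam v (w t)) (at t within {0..})"
  using assms gradient_eqI[OF GDERIV_loss_diag] by (simp add: gradient_flow_def)

text \<open>The loss stays below its initial value and dominates 3 (s - 1)^2, which confines s for
  all times.\<close>

lemma gradient_flow_loss_diag_bounded:
  assumes flow: "gradient_flow (loss (diag_matrix lam) v) w"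
  obtains K where "\<And>t. t \<ge> 0 \<Longrightarrow> 0 \<le> w t \<bullet> (diag_matrix lam *v w t)"
    "\<And>t. t \<ge> 0 \<Longrightarrow> w t \<bullet> (diag_matrix lam *v w t) \<le> K"
proof
  fix t :: real assume t: "t \<ge> 0"
  let ?L = "loss (diag_matrix lam) v" and ?s = "w t \<bullet> (diag_matrix lam *v w t)"
  show "0 \<le> ?s"
    unfolding inner_diag_matrix using pos by (intro sum_nonneg) (simp add: less_imp_le)
  have "GDERIV ?L x :> gradient ?L x" for x
    using GDERIV_loss_diag[of x] gradient_eqI[OF GDERIV_loss_diag[of x]] by simp
  then have loss_le: "?L (w t) \<le> ?L (w 0)"
    by (rule gradient_flow_nonincreasing[OF flow _ t])
  have "3 * (?s - 1)\<^sup>2 \<le> ?L (w 0)"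
    using loss_diag_ge[of "w t"] loss_le by linarith
  then have "?s - 1 \<le> sqrt (?L (w 0) / 3)"
    by (intro real_le_rsqrt) simp
  then show "?s \<le> 1 + sqrt (?L (w 0) / 3)" by simp
qed

text \<open>Every eigenvalue is positive, so each summand of s controls one coordinate of w.\<close>

lemma bounded_gradient_flow_loss_diag:
  assumes "gradient_flow (loss (diag_matrix lam) v) w"
  shows "bounded (w ` {0..})"
proof -
  obtain K where K: "\<And>t. t \<ge> 0 \<Longrightarrow> w t \<bullet> (diag_matrix lam *v w t) \<le> K"
    using gradient_flow_loss_diag_bounded[OF assms] by blast
  have "norm (w t) \<le> (\<Sum>i\<in>UNIV. sqrt (K / lam $ i))" if "t \<ge> 0" for t
  proof -
    have "\<bar>w t $ i\<bar> \<le> sqrt (K / lam $ i)" for i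
    proof (rule real_le_rsqrt)
      have "lam $ i * (w t $ i * w t $ i) \<le> w t \<bullet> (diag_matrix lam *v w t)"
        unfolding inner_diag_matrix using pos by (intro member_le_sum) (auto simp: less_imp_le)
      also have "\<dots> \<le> K" using K that by blast
      finally show "\<bar>w t $ i\<bar>\<^sup>2 \<le> K / lam $ i"
        using pos by (simp add: pos_le_divide_eq power2_eq_square mult.commute)
    qed
    then show ?thesis
      using norm_le_l1_cart[of "w t"] by (meson order_trans sum_mono)
  qed
  then show ?thesis by (auto simp: bounded_iff)
qed

end

section \<open>The moment map into \<open>ell2\<close>\<close>

context
  fixes lam v :: "real^'n"
  assumes card: "CARD('n) \<ge> 2" and pos: "\<And>i. lam $ i > 0" and tr: "trace (diag_matrix lam) = 1"
begin

text \<open>With at least two positive eigenvalues of total 1, each is below 1, so the moments decay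
  geometrically and \<open>Abs_ell2\<close> is applied to a genuine element.\<close>

lemma ell2_nth_moments: "ell2_nth (moments lam v x) k = x \<bullet> (matrix_pow (diag_matrix lam) (Suc k) *v v)"
  unfolding moments_def by (subst ell2_nth_Abs[OF square_summable_moments[OF card pos tr]]) simp

lemma bounded_linear_moments: "bounded_linear (moments lam v)"
  unfolding linear_conv_bounded_linear[symmetric]
  by (intro linearI ell2_eqI)
     (simp_all add: ell2_nth_moments ell2_nth_add ell2_nth_scaleR inner_add_left)

lemma moments_diag_mult: "moments lam v (diag_matrix lam *v x) = ell2_shift (moments lam v x)"
  by (rule ell2_eqI) (simp only: ell2_nth_moments ell2_nth_shift inner_matrix_pow_Suc_diag)

lemma moments_flow_field:
  "moments lam v (flow_field lam v w) =
     (4 * (1 - 3 * (w \<bullet> (diag_matrix lam *v w)))) *\<^sub>R ell2_shift (moments lam v w)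
     + (8 * (w \<bullet> (diag_matrix lam *v v))) *\<^sub>R ell2_shift (moments lam v v)"
  unfolding flow_field_def
    linear_add[OF bounded_linear.linear[OF bounded_linear_moments]]
    linear_scale[OF bounded_linear.linear[OF bounded_linear_moments]]
    moments_diag_mult ..

text \<open>This puts U in the form required by \<open>Cb_infty_polynomial_flow\<close>: finitely
  many fixed vectors with the coordinates of w as coefficients.\<close>

lemma moments_eq_sum: "moments lam v x = (\<Sum>i\<in>UNIV. (x $ i) *\<^sub>R moments lam v (axis i 1))"
proof -
  interpret bounded_linear "moments lam v" by (rule bounded_linear_moments)
  show ?thesis
    by (subst basis_expansion[symmetric, of x]) (simp add: sum scaleR scalar_mult_eq_scaleR)
qed

end

theorem lemma1:
  fixes lam wstar :: "real^('n::{finite,linorder})"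
    and w :: "real \<Rightarrow> real^('n::{finite,linorder})"
  defines "Q \<equiv> diag_matrix lam"
  defines "s \<equiv> \<lambda>t. w t \<bullet> (Q *v w t)"
    and "u \<equiv> \<lambda>k t. w t \<bullet> (matrix_pow Q k *v wstar)"
    and "sstar \<equiv> Abs_ell2 (\<lambda>k. wstar \<bullet> (matrix_pow Q (Suc k) *v wstar))"
  defines "U0 \<equiv> Abs_ell2 (\<lambda>k. u (Suc k) 0)"
    and "B \<equiv> ell2_shift"
  defines "S \<equiv> rank_one (blinfun_apply B sstar) ell2_e1"
    and "Theta \<equiv> \<lambda>t. integral {0..t} (\<lambda>\<tau>. 1 - 3 * s \<tau>)"
  defines "A \<equiv> \<lambda>t. (4 * (1 - 3 * s t)) *\<^sub>R B + 8 *\<^sub>R S"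
  assumes "CARD('n) \<ge> 2"
    and "\<And>i j. i \<le> j \<Longrightarrow> lam $ j \<le> lam $ i"
    and "\<And>i. lam $ i > 0"
    and "trace Q = 1"
    and "wstar \<bullet> (Q *v wstar) = 1"
    and "gradient_flow (loss Q wstar) w"
  shows "\<exists>U\<in>Cb_infty. solves_linear_ivp A U0 U
    \<and> (\<forall>V\<in>Cb_infty. solves_linear_ivp A U0 V \<longrightarrow> (\<forall>t\<ge>0. V t = U t))
    \<and> (\<forall>\<tau>\<ge>0. u 1 \<tau> = ell2_e1 \<bullet> U \<tau>)
    \<and> (\<forall>t\<ge>0. U t = blinfun_apply (blinfun_exp ((4 * Theta t) *\<^sub>R B)) U0
          + 8 *\<^sub>R integral {0..t} (\<lambda>\<tau>. u 1 \<tau> *\<^sub>R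
              blinfun_apply (blinfun_exp ((4 * (Theta t - Theta \<tau>)) *\<^sub>R B)) (blinfun_apply B sstar)))"
proof -
  note card = assms(10) and pos = assms(12) and tr = assms(13)[unfolded Q_def]
    and wstar = assms(14)[unfolded Q_def] and flow = assms(15)[unfolded Q_def]
  define M where "M = moments lam wstar"
  define U where "U t = M (w t)" for t
  have sstar: "sstar = M wstar" and U0: "U0 = U 0"
    by (simp_all add: sstar_def U0_def U_def M_def moments_def u_def Q_def)
  have M: "bounded_linear M"
    unfolding M_def by (rule bounded_linear_moments[OF card pos tr])
  have u1: "u 1 t = w t \<bullet> (Q *v wstar)" for t
    unfolding u_def matrix_pow_1 ..
  \<comment> \<open>\<open>ell2_e1\<close> selects the entry with index 0, which is the moment of
    exponent 1.\<close>
  have e1: "ell2_e1 \<bullet> U t = u 1 t" for t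
    by (simp add: inner_ell2_e1 U_def M_def ell2_nth_moments[OF card pos tr] u_def Q_def)
  have w': "(w has_vector_derivative flow_field lam wstar (w t)) (at t within {0..})" if "t \<ge> 0" for t
    by (rule has_vector_derivative_gradient_flow_loss_diag[OF pos wstar flow that])
  have U': "(U has_vector_derivative (4 * (1 - 3 * s t)) *\<^sub>R B (U t) + (8 * u 1 t) *\<^sub>R B sstar) (at t within {0..})"
    if "t \<ge> 0" for t
    using bounded_linear.has_vector_derivative[OF M w'[OF that]]
    unfolding M_def moments_flow_field[OF card pos tr] u1
    by (simp add: U_def[abs_def] M_def sstar B_def s_def Q_def)
  \<comment> \<open>The forcing term is 8 S U, because S multiplies \<open>B sstar\<close> by the
    first entry of U, namely u^(1).\<close>
  have U_solves: "solves_linear_ivp A U0 U"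
    using U'
    by (simp add: solves_linear_ivp_def U0 A_def S_def rank_one.rep_eq e1 blinfun.add_left blinfun.scaleR_left)
  have U_Cb: "U \<in> Cb_infty"
  proof -
    have "U = (\<lambda>t. \<Sum>i\<in>UNIV. (w t $ i) *\<^sub>R M (axis i 1))"
      unfolding U_def[abs_def] M_def by (subst moments_eq_sum[OF card pos tr]) simp
    moreover have "bounded (U ` {0..})"
      using bounded_linear_image[OF bounded_gradient_flow_loss_diag[OF pos wstar flow] M]
      by (simp add: U_def[abs_def] image_image)
    ultimately show ?thesis
      using Cb_infty_polynomial_flow[OF w' polynomial_function_flow_field, of UNIV "\<lambda>i x. x $ i" "\<lambda>i. M (axis i 1)"]
      by (simp add: real_polynomial_function.intros(1) bounded_linear_vec_nth)
  qed
  obtain K where K: "\<And>t. t \<ge> 0 \<Longrightarrow> 0 \<le> s t" "\<And>t. t \<ge> 0 \<Longrightarrow> s t \<le> K"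
    using gradient_flow_loss_diag_bounded[OF pos wstar flow] unfolding s_def Q_def by blast
  \<comment> \<open>Since s lies between 0 and K, the modulus of 1 - 3 s is at most 1 + 3 K; this
    gives the bound uniform in time for the Gronwall argument.\<close>
  have A_bound: "norm (A t) \<le> 4 * (1 + 3 * K) * norm B + 8 * norm S" if "t \<ge> 0" for t
  proof -
    have "\<bar>4 * (1 - 3 * s t)\<bar> \<le> 4 * (1 + 3 * K)"
      using K[OF that] by (simp add: abs_le_iff)
    then have "norm ((4 * (1 - 3 * s t)) *\<^sub>R B) \<le> 4 * (1 + 3 * K) * norm B"
      unfolding norm_scaleR by (intro mult_right_mono) auto
    then show ?thesis
      unfolding A_def by (intro norm_triangle_le) simp
  qed
  have U_unique: "V t = U t" if "solves_linear_ivp A U0 V" "t \<ge> 0" for V t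
    by (rule solves_linear_ivp_unique[OF that(1) U_solves A_bound that(2)])
  have duhamel: "U t = blinfun_exp ((4 * Theta t) *\<^sub>R B) U0
      + 8 *\<^sub>R integral {0..t} (\<lambda>\<tau>. u 1 \<tau> *\<^sub>R blinfun_exp ((4 * (Theta t - Theta \<tau>)) *\<^sub>R B) (B sstar))"
    if t: "t \<ge> 0" for t
  proof -
    \<comment> \<open>Continuity of s makes the integral \<open>Theta\<close> differentiable with
      derivative 1 - 3 s.\<close>
    have w_cont: "continuous_on {0..t} w"
      by (rule continuous_on_subset[OF continuous_on_vector_derivative[of "{0..}", OF w']]) auto
    then have s_cont: "continuous_on {0..t} (\<lambda>\<tau>. 1 - 3 * s \<tau>)"
      unfolding s_def by (intro continuous_intros bounded_linear.continuous_on[OF matrix_vector_mul_bounded_linear])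
    \<comment> \<open>Variation of constants with c = 4 \<open>Theta\<close> and forcing 8 u^(1)
      \<open>B sstar\<close>; the coefficient u^(1) is treated as a known function of time.\<close>
    have "((\<lambda>\<tau>. blinfun_exp ((4 * Theta t - 4 * Theta \<tau>) *\<^sub>R B) ((8 * u 1 \<tau>) *\<^sub>R B sstar)) has_integral
        (U t - blinfun_exp ((4 * Theta t - 4 * Theta 0) *\<^sub>R B) (U 0))) {0..t}"
    proof (rule variation_of_constants_blinfun_exp[OF t])
      fix \<tau> assume \<tau>: "\<tau> \<in> {0..t}"
      from integral_has_vector_derivative[OF s_cont \<tau>]
      have "(Theta has_real_derivative 1 - 3 * s \<tau>) (at \<tau> within {0..t})"
        by (simp add: Theta_def[abs_def] has_real_derivative_iff_has_vector_derivative)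
      then show "((\<lambda>\<tau>. 4 * Theta \<tau>) has_real_derivative 4 * (1 - 3 * s \<tau>)) (at \<tau> within {0..t})"
        by (rule DERIV_cmult)
      show "(U has_vector_derivative (4 * (1 - 3 * s \<tau>)) *\<^sub>R B (U \<tau>) + (8 * u 1 \<tau>) *\<^sub>R B sstar) (at \<tau> within {0..t})"
        by (rule has_vector_derivative_within_subset[OF U']) (use \<tau> in auto)
    qed
    moreover have "Theta 0 = 0" by (simp add: Theta_def)
    ultimately have "((\<lambda>\<tau>. 8 *\<^sub>R (u 1 \<tau> *\<^sub>R blinfun_exp ((4 * (Theta t - Theta \<tau>)) *\<^sub>R B) (B sstar))) has_integral
        (U t - blinfun_exp ((4 * Theta t) *\<^sub>R B) U0)) {0..t}"
      by (simp add: blinfun.scaleR_right right_diff_distrib U0)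
    from integral_unique[OF this] show ?thesis
      unfolding integral_cmul by (simp only: eq_diff_eq add.commute)
  qed
  show ?thesis
  proof (intro bexI[OF _ U_Cb] conjI ballI allI impI)
    show "solves_linear_ivp A U0 U" by (rule U_solves)
    show "V t = U t" if "solves_linear_ivp A U0 V" "t \<ge> 0" for V t
      by (rule U_unique[OF that])
    show "u 1 t = ell2_e1 \<bullet> U t" for t
      by (rule e1[symmetric])
  qed (rule duhamel)
qed

end
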